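(* Let $T$ be a $d$-dimensional simplex in a Minkowski space $\mathbb{M}^d(B)$, and let $T^*_G$ be the $d$-simplex which is the dual body of $T$ with respect to the centroid $G$ of $T$. Then the following conditions are equivalent. 1. $T$ is $AG$-quasiregular in $\mathbb{M}^d(B)$. 2. The medians of $T$ have the same length in $\mathbb{M}^d(B)$. 3. The Minkowskian heights of $T^*_G$ are equal in $\mathbb{M}^d(B^* )$, where $B^*$ is the dual body to $B$. 4. The class of quasi-medial hyperplanes of $T^*_G$ coincides with the class of Minkowskian bisectors of $T^*_G$ in $\mathbb{M}^d(B^* )$. 5. The centroid of $T^*_G$ coincides with the Minkowskian incenter of $T^*_G$ in $\mathbb{M}^d(B^* )$. 6. The Minkowskian exradii of $T^*_G$ are all equal in $\mathbb{M}^d(B^* )$.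
   Context: $\mathbb{M}^d(B)$ denotes $\mathbb{R}^d$ with the norm whose unit ball is $B$ (a convex body centered at the origin). Fix an auxiliary inner product $\langle\cdot,\cdot\rangle$ on $\mathbb{R}^d$. The dual unit ball is $B^*=\{y:\langle x,y\rangle\le1\text{ for all }x\in B\}$. The dual body of a convex body $K$ with respect to a point $P$ is its polar reciprocal with respect to the auxiliary Euclidean structure, with $P$ in the role of the origin: $K_P^*=\{P+y:\langle x-P,y\rangle\le 1\text{ for all }x\in K\}$. For a $d$-simplex with vertices $A_0,\dots,A_d$: the centroid is $G=\frac{1}{d+1}\sum_iA_i$; the medians are the segments $[A_iA_i']$ with $A_i'=\frac1d\sum_{j\neq i}A_j$. A circumcenter is the center of a sphere of the given norm (of positive radius) containing all vertices; the simplex is $AG$-quasiregular if it possesses a circumcenter and its centroid is a circumcenter. The Minkowskian distance from a point $P$ to a hyperplane $H$ is the radius of a smallest ball (of the given norm) centered at $P$ such that $H$ is tangent to this ball. The Minkowskian height with respect to a vertex is the Minkowskian distance of that vertex to the hyperplane containing the opposite facet. A quasi-medial hyperplane is a hyperplane containing a $(d-2)$-face and the midpoint of the opposite edge. A (Minkowskian) bisector of two given intersecting hyperplanes is a hyperplane each of whose points has equal Minkowskian distance to the two hyperplanes; for each pair of adjacent facets of a simplex this gives rise to an interior bisector (containing interior points of the simplex) and an exterior bisector (not containing interior points of the simplex). The incenter is the intersection of all interior bisectors, i.e. the center of the insphere. There are up to $d+1$ exspheres (also called exballs or escribed balls) associated to each $d$-simplex, one for each facet $F$ for which it exists: a ball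 tangent to all $d+1$ facet hyperplanes, whose center lies on the other side of $\mathrm{aff}(F)$ from the simplex and on the same side as the simplex for every other facet hyperplane, so that the center is found as an intersection of interior and exterior bisectors. The radii of the exspheres are the exradii.
   Formalization: Condition 6 is taken to require that all d+1 exspheres exist and have equal radii (comparing only existing ones makes the claim false); in condition 4 the bisectors are the interior bisectors (exterior ones are never quasi-medial); d is at least 2. *)

theory Defs
  imports "HOL-Analysis.Analysis"
begin

text \<open>
  The Minkowski space \<open>M^d(B)\<close> is a Euclidean space \<open>'a\<close> with \<open>d = DIM('a)\<close>, renormed by the
  gauge of \<open>B\<close>. The auxiliary inner product is the one of \<open>'a\<close>; being arbitrary, \<open>'a\<close> accounts
  for every choice of it.
\<close>

definition centered_convex_body :: "'a::euclidean_space set \<Rightarrow> bool" where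
  "centered_convex_body B \<longleftrightarrow>
     compact B \<and> convex B \<and> interior B \<noteq> {} \<and> (\<forall>x\<in>B. - x \<in> B)"

definition mnorm :: "'a::euclidean_space set \<Rightarrow> 'a \<Rightarrow> real" where
  "mnorm B x = Inf {t. 0 \<le> t \<and> x \<in> (\<lambda>y. t *\<^sub>R y) ` B}"

definition mball :: "'a::euclidean_space set \<Rightarrow> 'a \<Rightarrow> real \<Rightarrow> 'a set" where
  "mball B c r = {x. mnorm B (x - c) \<le> r}"

definition msphere :: "'a::euclidean_space set \<Rightarrow> 'a \<Rightarrow> real \<Rightarrow> 'a set" where
  "msphere B c r = {x. mnorm B (x - c) = r}"

definition dual_body :: "'a::euclidean_space set \<Rightarrow> 'a \<Rightarrow> 'a set" where
  "dual_body K P = {P + y | y. \<forall>x\<in>K. (x - P) \<bullet> y \<le> 1}"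

definition dual_ball :: "'a::euclidean_space set \<Rightarrow> 'a set" where
  "dual_ball B = {y. \<forall>x\<in>B. x \<bullet> y \<le> 1}"


text \<open>
  A \<open>d\<close>-simplex is a set \<open>S\<close> with \<open>int DIM('a) simplex S\<close>. The definitions below refer to its
  vertices, and index each facet by the vertex opposite to it.
\<close>

definition verts :: "'a::euclidean_space set \<Rightarrow> 'a set" where
  "verts S = {v. v extreme_point_of S}"

definition simplex_centroid :: "'a::euclidean_space set \<Rightarrow> 'a" where
  "simplex_centroid S = (1 / (real DIM('a) + 1)) *\<^sub>R (\<Sum>v\<in>verts S. v)"

definition opposite_facet :: "'a::euclidean_space set \<Rightarrow> 'a \<Rightarrow> 'a set" where
  "opposite_facet S v = convex hull (verts S - {v})"

definition facet_hyperplane :: "'a::euclidean_space set \<Rightarrow> 'a \<Rightarrow> 'a set" where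
  "facet_hyperplane S v = affine hull (opposite_facet S v)"

definition median_foot :: "'a::euclidean_space set \<Rightarrow> 'a \<Rightarrow> 'a" where
  "median_foot S v = (1 / real DIM('a)) *\<^sub>R (\<Sum>w\<in>verts S - {v}. w)"

definition median_length :: "'a::euclidean_space set \<Rightarrow> 'a set \<Rightarrow> 'a \<Rightarrow> real" where
  "median_length B S v = mnorm B (median_foot S v - v)"

definition is_circumcenter :: "'a::euclidean_space set \<Rightarrow> 'a set \<Rightarrow> 'a \<Rightarrow> bool" where
  "is_circumcenter B S c \<longleftrightarrow> (\<exists>r>0. verts S \<subseteq> msphere B c r)"

definition AG_quasiregular :: "'a::euclidean_space set \<Rightarrow> 'a set \<Rightarrow> bool" where
  "AG_quasiregular B S \<longleftrightarrow>
     (\<exists>c. is_circumcenter B S c) \<and> is_circumcenter B S (simplex_centroid S)"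


definition is_hyperplane :: "'a::euclidean_space set \<Rightarrow> bool" where
  "is_hyperplane H \<longleftrightarrow> (\<exists>a b. a \<noteq> 0 \<and> H = {x. a \<bullet> x = b})"

definition tangent_to :: "'a::euclidean_space set \<Rightarrow> 'a set \<Rightarrow> bool" where
  "tangent_to H C \<longleftrightarrow> H \<inter> C \<noteq> {} \<and> H \<inter> interior C = {}"

text \<open>
  Radius \<open>0\<close> is allowed in the next definition: the degenerate ball around \<open>P\<close> has empty interior,
  so it is tangent to \<open>H\<close> exactly if \<open>P\<close> lies on \<open>H\<close>, and the distance is then \<open>0\<close>.
\<close>

definition mdist_hyperplane :: "'a::euclidean_space set \<Rightarrow> 'a \<Rightarrow> 'a set \<Rightarrow> real" where
  "mdist_hyperplane B P H = (LEAST r. 0 \<le> r \<and> tangent_to H (mball B P r))"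

definition mheight :: "'a::euclidean_space set \<Rightarrow> 'a set \<Rightarrow> 'a \<Rightarrow> real" where
  "mheight B S v = mdist_hyperplane B v (facet_hyperplane S v)"

text \<open>The face opposite to the edge \<open>[v, w]\<close> is spanned by the remaining vertices.\<close>

definition quasi_medial_hyperplanes :: "'a::euclidean_space set \<Rightarrow> 'a set set" where
  "quasi_medial_hyperplanes S =
     {H. is_hyperplane H \<and>
         (\<exists>v\<in>verts S. \<exists>w\<in>verts S. v \<noteq> w \<and>
            convex hull (verts S - {v, w}) \<subseteq> H \<and> midpoint v w \<in> H)}"

definition is_bisector ::
  "'a::euclidean_space set \<Rightarrow> 'a set \<Rightarrow> 'a set \<Rightarrow> 'a set \<Rightarrow> bool" where
  "is_bisector B H1 H2 H \<longleftrightarrow>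
     is_hyperplane H \<and> (\<forall>p\<in>H. mdist_hyperplane B p H1 = mdist_hyperplane B p H2)"

definition interior_bisectors :: "'a::euclidean_space set \<Rightarrow> 'a set \<Rightarrow> 'a set set" where
  "interior_bisectors B S =
     {H. H \<inter> interior S \<noteq> {} \<and>
         (\<exists>v\<in>verts S. \<exists>w\<in>verts S. v \<noteq> w \<and>
            is_bisector B (facet_hyperplane S v) (facet_hyperplane S w) H)}"

definition is_incenter :: "'a::euclidean_space set \<Rightarrow> 'a set \<Rightarrow> 'a \<Rightarrow> bool" where
  "is_incenter B S c \<longleftrightarrow> \<Inter> (interior_bisectors B S) = {c}"


definition same_side :: "'a::euclidean_space set \<Rightarrow> 'a \<Rightarrow> 'a \<Rightarrow> bool" where
  "same_side H x y \<longleftrightarrow> closed_segment x y \<inter> H = {}"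

definition other_side :: "'a::euclidean_space set \<Rightarrow> 'a \<Rightarrow> 'a \<Rightarrow> bool" where
  "other_side H x y \<longleftrightarrow> x \<notin> H \<and> y \<notin> H \<and> closed_segment x y \<inter> H \<noteq> {}"

text \<open>
  \<open>is_exball B S v c r\<close>: the ball with center \<open>c\<close> and radius \<open>r\<close> is the exball of \<open>S\<close> belonging to
  the facet opposite to \<open>v\<close>.
\<close>

definition is_exball ::
  "'a::euclidean_space set \<Rightarrow> 'a set \<Rightarrow> 'a \<Rightarrow> 'a \<Rightarrow> real \<Rightarrow> bool" where
  "is_exball B S v c r \<longleftrightarrow>
     0 < r \<and>
     (\<forall>w\<in>verts S. tangent_to (facet_hyperplane S w) (mball B c r)) \<and>
     (\<forall>x\<in>interior S. other_side (facet_hyperplane S v) c x) \<and>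
     (\<forall>w\<in>verts S - {v}. \<forall>x\<in>interior S. same_side (facet_hyperplane S w) c x)"

definition exradii :: "'a::euclidean_space set \<Rightarrow> 'a set \<Rightarrow> real set" where
  "exradii B S = {r. \<exists>v\<in>verts S. \<exists>c. is_exball B S v c r}"

text \<open>
  Some facet may lack an exball; equality of the exradii is understood to include that all of the
  \<open>d + 1\<close> exballs exist. Comparing only the existing ones would be too weak: for \<open>d = 2\<close> and
  \<open>B\<close> the unit ball of the maximum norm, let \<open>T\<close> be the triangle with vertices \<open>(1, 1)\<close>,
  \<open>(1, -1)\<close>, \<open>(-2, 0)\<close>. Its dual body with respect to the centroid has just two exballs for the
  dual norm, and these have equal radii, but \<open>T\<close> is not \<open>AG\<close>-quasiregular.
\<close>

definition exradii_all_equal :: "'a::euclidean_space set \<Rightarrow> 'a set \<Rightarrow> bool" where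
  "exradii_all_equal B S \<longleftrightarrow>
     (\<forall>v\<in>verts S. \<exists>c r. is_exball B S v c r) \<and>
     (\<forall>r\<in>exradii B S. \<forall>s\<in>exradii B S. r = s)"

end

theory Submission
  imports Defs
begin

text \<open>
  Put the centroid \<open>G\<close> of \<open>T\<close> at the origin, let \<open>a\<^sub>i\<close> be the vertices of \<open>T\<close> and \<open>b\<^sub>i\<close> those of the
  polar simplex. Then \<open>a\<^sub>i \<bullet> b\<^sub>j = 1\<close> for \<open>i \<noteq> j\<close> and \<open>a\<^sub>i \<bullet> b\<^sub>i = - d\<close>, so the polar also has centroid
  \<open>G\<close>, and its facet opposite to \<open>b\<^sub>i\<close> spans \<open>{y. a\<^sub>i \<bullet> y = 1}\<close>. By the bipolar theorem, the distance in
  \<open>M\<^sup>d(B\<^sup>*)\<close> from \<open>p\<close> to that hyperplane is \<open>\<bar>1 - a\<^sub>i \<bullet> p\<bar> / h\<^sub>i\<close>, where \<open>h\<^sub>i\<close> is the norm of \<open>a\<^sub>i\<close> in \<open>M\<^sup>d(B)\<close>.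
  Each condition now says that all \<open>h\<^sub>i\<close> agree: the medians have length \<open>(d + 1) h\<^sub>i / d\<close>; the heights are
  \<open>(d + 1) / h\<^sub>i\<close>; the interior bisectors are \<open>(1 - a\<^sub>i \<bullet> p) / h\<^sub>i = (1 - a\<^sub>j \<bullet> p) / h\<^sub>j\<close>, while the
  quasi-medial hyperplanes are \<open>a\<^sub>i \<bullet> p = a\<^sub>j \<bullet> p\<close> and all contain the centroid; and an exradius \<open>r\<close>
  satisfies \<open>r (\<Sum>\<^sub>j h\<^sub>j - 2 h\<^sub>i) = d + 1\<close>.
\<close>

subsection \<open>Polarity and the dual norm\<close>

text \<open>The interior is symmetric and convex, so it contains the midpoint of an interior point
  and its mirror image.\<close>

lemma zero_in_interior_centered_convex_body:
  assumes "centered_convex_body B"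
  shows "0 \<in> interior B"
proof -
  have cv: "convex B" and int: "interior B \<noteq> {}" and sym: "\<And>x. x \<in> B \<Longrightarrow> - x \<in> B"
    using assms by (auto simp: centered_convex_body_def)
  obtain x where x: "x \<in> interior B" using int by blast
  have "uminus ` B = B" using sym by force
  then have "uminus ` interior B = interior B"
    by (metis interior_negations)
  then have "- x \<in> interior B" using x by blast
  then have "(1/2) *\<^sub>R x + (1/2) *\<^sub>R (- x) \<in> interior B"
    using convexD[OF convex_interior[OF cv] x, of "-x" "1/2" "1/2"] by simp
  then show ?thesis by simp
qed

lemma compact_dual_ball:
  assumes "0 \<in> interior B"
  shows "compact (dual_ball B)"
proof -
  obtain e where e: "e > 0" "cball 0 e \<subseteq> B"
    using assms by (auto simp: mem_interior_cball)
  have "norm y \<le> 1 / e" if "y \<in> dual_ball B" for y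
  proof (cases "y = 0")
    case False
    \<comment> \<open>Testing \<open>y\<close> against the point of the small ball in its own
      direction bounds \<open>norm y\<close> by \<open>1 / e\<close>.\<close>
    have "(e / norm y) *\<^sub>R y \<in> B" using e False by (intro subsetD[OF e(2)]) auto
    then have "((e / norm y) *\<^sub>R y) \<bullet> y \<le> 1" using that by (auto simp: dual_ball_def)
    then have "e * norm y \<le> 1" using False by (simp add: dot_square_norm power2_eq_square)
    then show ?thesis using e by (simp add: field_simps)
  qed (use e in auto)
  then have "bounded (dual_ball B)" by (auto simp: bounded_iff)
  moreover have "dual_ball B = (\<Inter>x\<in>B. {y. x \<bullet> y \<le> 1})" by (auto simp: dual_ball_def)
  then have "closed (dual_ball B)" by (auto intro: closed_halfspace_le)
  ultimately show ?thesis by (simp add: compact_eq_bounded_closed)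
qed

lemma zero_in_interior_dual_ball:
  assumes "bounded B"
  shows "0 \<in> interior (dual_ball B)"
proof -
  obtain R where R: "R > 0" "\<And>x. x \<in> B \<Longrightarrow> norm x \<le> R"
    using assms by (auto simp: bounded_pos)
  have "cball 0 (1 / R) \<subseteq> dual_ball B"
  proof
    fix y :: 'a assume y: "y \<in> cball 0 (1 / R)"
    have "x \<bullet> y \<le> 1" if "x \<in> B" for x
    proof -
      have "x \<bullet> y \<le> norm x * norm y" by (rule norm_cauchy_schwarz)
      also have "\<dots> \<le> R * (1 / R)" using R that y by (intro mult_mono) auto
      finally show ?thesis using R by simp
    qed
    then show "y \<in> dual_ball B" by (simp add: dual_ball_def)
  qed
  then show ?thesis using R by (auto simp: mem_interior_cball intro!: exI[of _ "1/R"])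
qed

text \<open>The bipolar theorem: a point outside \<open>B\<close> is strictly separated from
  \<open>B\<close>, and since 0 lies in \<open>B\<close> the separating functional can be scaled
  into the polar.\<close>

lemma dual_ball_dual_ball:
  assumes "closed B" "convex B" "0 \<in> B"
  shows "dual_ball (dual_ball B) = B"
proof
  show "B \<subseteq> dual_ball (dual_ball B)" by (auto simp: dual_ball_def inner_commute)
  show "dual_ball (dual_ball B) \<subseteq> B"
  proof (rule subsetI, rule ccontr)
    fix z assume z: "z \<in> dual_ball (dual_ball B)" "z \<notin> B"
    obtain a b where ab: "a \<bullet> z < b" "\<And>x. x \<in> B \<Longrightarrow> a \<bullet> x > b"
      using separating_hyperplane_closed_point[OF assms(2,1) z(2)] by blast
    have b: "b < 0" using ab(2)[OF assms(3)] by simp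
    \<comment> \<open>Division by the negative \<open>b\<close> reverses both inequalities: the
      scaled functional is below 1 on \<open>B\<close> but exceeds 1 at \<open>z\<close>.\<close>
    have "a /\<^sub>R b \<in> dual_ball B"
      using ab(2) b by (auto simp: dual_ball_def field_simps inner_commute less_imp_le)
    then have "(a /\<^sub>R b) \<bullet> z \<le> 1" using z(1) unfolding dual_ball_def by blast
    then show False using b ab(1) by (simp add: field_simps)
  qed
qed

text \<open>The gauge of the polar of \<open>L\<close> is the support function of \<open>L\<close>:
  \<open>x\<close> lies in \<open>t\<close> times the polar exactly if \<open>t\<close> is at least
  the maximum of \<open>y \<bullet> x\<close> over \<open>L\<close>.\<close>

lemma mnorm_dual_ball:
  assumes "compact L" "0 \<in> interior L"
  shows "\<exists>y\<in>L. y \<bullet> x = mnorm (dual_ball L) x"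
    and "y \<in> L \<Longrightarrow> y \<bullet> x \<le> mnorm (dual_ball L) x"
proof -
  have ne: "L \<noteq> {}" and 0: "0 \<in> L" using assms(2) interior_subset by auto
  have "continuous_on L (\<lambda>y. y \<bullet> x)" by (intro continuous_intros)
  then obtain w where w: "w \<in> L" "\<And>y. y \<in> L \<Longrightarrow> y \<bullet> x \<le> w \<bullet> x"
    using continuous_attains_sup[OF assms(1) ne] by blast
  have pos: "0 \<le> w \<bullet> x" using w(2)[OF 0] by simp
  have "{t. 0 \<le> t \<and> x \<in> (\<lambda>y. t *\<^sub>R y) ` dual_ball L} = {w \<bullet> x..}"
  proof (intro subset_antisym subsetI)
    fix t assume "t \<in> {t. 0 \<le> t \<and> x \<in> (\<lambda>y. t *\<^sub>R y) ` dual_ball L}"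
    then obtain z where z: "0 \<le> t" "x = t *\<^sub>R z" "z \<in> dual_ball L" by auto
    then have "w \<bullet> z \<le> 1" using w(1) by (auto simp: dual_ball_def)
    then show "t \<in> {w \<bullet> x..}" using z by (simp add: mult_left_le)
  next
    fix t assume t: "t \<in> {w \<bullet> x..}"
    show "t \<in> {t. 0 \<le> t \<and> x \<in> (\<lambda>y. t *\<^sub>R y) ` dual_ball L}"
    proof (cases "t = 0")
      \<comment> \<open>Zero times the polar is just the origin, so here \<open>x = 0\<close> is
        needed; a nonzero \<open>x\<close> would have a positive product with a point of the small
        ball in \<open>L\<close>.\<close>
      case True
      obtain e where e: "e > 0" "cball 0 e \<subseteq> L"
        using assms(2) by (auto simp: mem_interior_cball)
      have "x = 0"
      proof (rule ccontr)
        assume x: "x \<noteq> 0"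
        then have "(e / norm x) *\<^sub>R x \<in> L" using e by (intro subsetD[OF e(2)]) auto
        then have "((e / norm x) *\<^sub>R x) \<bullet> x \<le> 0" using w(2) t True by fastforce
        moreover have "0 < ((e / norm x) *\<^sub>R x) \<bullet> x" using e x by simp
        ultimately show False by linarith
      qed
      moreover have "0 \<in> dual_ball L" by (simp add: dual_ball_def)
      ultimately show ?thesis using True by auto
    next
      case False
      then have t0: "t > 0" using t pos by simp
      have "x /\<^sub>R t \<in> dual_ball L"
        using w(2) t t0 by (fastforce simp: dual_ball_def field_simps)
      then show ?thesis using t0 by (auto intro!: image_eqI[of _ _ "x /\<^sub>R t"])
    qed
  qed
  then have eq: "mnorm (dual_ball L) x = w \<bullet> x" by (simp add: mnorm_def)
  show "\<exists>y\<in>L. y \<bullet> x = mnorm (dual_ball L) x" using w eq by auto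
  show "y \<in> L \<Longrightarrow> y \<bullet> x \<le> mnorm (dual_ball L) x" using w eq by auto
qed

section \<open>The norm of a body and the norm of its dual\<close>

locale minkowski_ball =
  fixes B :: "'a::euclidean_space set"
  assumes body: "centered_convex_body B"
begin

abbreviation "D \<equiv> dual_ball B"

lemma compact_B: "compact B" and sym_B: "x \<in> B \<Longrightarrow> - x \<in> B"
  using body by (auto simp: centered_convex_body_def)

lemma zero_B: "0 \<in> interior B"
  using body by (rule zero_in_interior_centered_convex_body)

lemma D_D: "dual_ball D = B"
  using body zero_B interior_subset
  by (intro dual_ball_dual_ball) (auto simp: centered_convex_body_def compact_imp_closed)

lemma compact_D: "compact D"
  using zero_B by (rule compact_dual_ball)

lemma zero_D: "0 \<in> interior D"
  using compact_imp_bounded[OF compact_B] by (rule zero_in_interior_dual_ball)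

lemma sym_D: "y \<in> D \<Longrightarrow> - y \<in> D"
  unfolding dual_ball_def using sym_B by fastforce

text \<open>By the bipolar theorem the norm of \<open>B\<close> is itself a support function, namely
  that of \<open>D\<close>. The homogeneity, symmetry and positivity of the norm are read off from
  this maximum instead of the infimum in \<open>mnorm_def\<close>.\<close>

lemma mnorm_attained: obtains y where "y \<in> D" "y \<bullet> x = mnorm B x"
  using mnorm_dual_ball(1)[OF compact_D zero_D, of x] D_D by auto

lemma mnorm_ge: "y \<in> D \<Longrightarrow> y \<bullet> x \<le> mnorm B x"
  using mnorm_dual_ball(2)[OF compact_D zero_D] D_D by auto

lemma mnorm_D_attained: obtains x where "x \<in> B" "x \<bullet> y = mnorm D y"
  using mnorm_dual_ball(1)[OF compact_B zero_B, of y] by auto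

lemma mnorm_D_ge: "x \<in> B \<Longrightarrow> x \<bullet> y \<le> mnorm D y"
  using mnorm_dual_ball(2)[OF compact_B zero_B] by auto

lemma mnorm_D_le_iff: "mnorm D y \<le> r \<longleftrightarrow> (\<forall>x\<in>B. x \<bullet> y \<le> r)"
  by (metis mnorm_D_attained mnorm_D_ge order_trans)

lemma mnorm_eqI:
  assumes "y \<in> D" "y \<bullet> x = m" "\<And>y. y \<in> D \<Longrightarrow> y \<bullet> x \<le> m"
  shows "mnorm B x = m"
  by (metis assms mnorm_attained mnorm_ge order_antisym)

lemma mnorm_scale_nonneg:
  assumes "0 \<le> c"
  shows "mnorm B (c *\<^sub>R x) = c * mnorm B x"
proof -
  obtain y where "y \<in> D" "y \<bullet> x = mnorm B x" by (rule mnorm_attained)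
  then show ?thesis
    using assms mnorm_ge by (intro mnorm_eqI[of y]) (auto intro: mult_left_mono)
qed

lemma mnorm_minus: "mnorm B (- x) = mnorm B x"
proof -
  obtain y where "y \<in> D" "y \<bullet> x = mnorm B x" by (rule mnorm_attained)
  then show ?thesis
    using mnorm_ge[OF sym_D] by (intro mnorm_eqI[of "-y"]) (auto intro: sym_D)
qed

lemma mnorm_pos:
  assumes "x \<noteq> 0"
  shows "0 < mnorm B x"
proof -
  obtain e where e: "e > 0" "cball 0 e \<subseteq> D"
    using zero_D by (auto simp: mem_interior_cball)
  have "(e / norm x) *\<^sub>R x \<in> D" using e assms by (intro subsetD[OF e(2)]) auto
  then have "((e / norm x) *\<^sub>R x) \<bullet> x \<le> mnorm B x" by (rule mnorm_ge)
  moreover have "0 < ((e / norm x) *\<^sub>R x) \<bullet> x" using e assms by simp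
  ultimately show ?thesis by linarith
qed

text \<open>Scaling \<open>w\<close> to dual norm 1 puts it into \<open>D\<close>, where the norm of
  \<open>z\<close> bounds the inner product. Scaling fails for dual norm 0, but then
  \<open>w = 0\<close>.\<close>

lemma Hoelder: "z \<bullet> w \<le> mnorm B z * mnorm D w"
proof -
  have nonneg: "0 \<le> mnorm D w"
    using mnorm_D_ge[of 0 w] zero_B interior_subset by auto
  consider "mnorm D w = 0" | "mnorm D w > 0" using nonneg by linarith
  then show ?thesis
  proof cases
    case 1
    obtain e where e: "e > 0" "cball 0 e \<subseteq> B"
      using zero_B by (auto simp: mem_interior_cball)
    have "w = 0"
    proof (rule ccontr)
      assume w: "w \<noteq> 0"
      then have "(e / norm w) *\<^sub>R w \<in> B" using e by (intro subsetD[OF e(2)]) auto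
      then have "((e / norm w) *\<^sub>R w) \<bullet> w \<le> 0" using mnorm_D_ge 1 by metis
      moreover have "0 < ((e / norm w) *\<^sub>R w) \<bullet> w" using e w by simp
      ultimately show False by linarith
    qed
    then show ?thesis using 1 by simp
  next
    case 2
    have "w /\<^sub>R mnorm D w \<in> D"
      using mnorm_D_ge[of _ w] 2 by (subst dual_ball_def) (auto simp: field_simps)
    from mnorm_ge[OF this, of z] show ?thesis using 2 by (simp add: field_simps inner_commute)
  qed
qed

section \<open>Tangent balls and the distance to a hyperplane\<close>

lemma interior_mball:
  assumes "mnorm D (x - P) < r"
  shows "x \<in> interior (mball D P r)"
proof -
  obtain R where R: "R > 0" "\<And>x. x \<in> B \<Longrightarrow> norm x \<le> R"
    using compact_imp_bounded[OF compact_B] by (auto simp: bounded_pos)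
  \<comment> \<open>As \<open>B\<close> lies in the Euclidean ball of radius \<open>R\<close>, a
    Euclidean move by \<open>e\<close> raises the dual norm by at most \<open>R * e\<close>, which
    is the room left below \<open>r\<close>.\<close>
  define e where "e = (r - mnorm D (x - P)) / R"
  have "cball x e \<subseteq> mball D P r"
  proof
    fix y assume "y \<in> cball x e"
    then have n: "norm (y - x) \<le> e" by (simp add: dist_norm norm_minus_commute)
    have "z \<bullet> (y - P) \<le> r" if z: "z \<in> B" for z
    proof -
      have "z \<bullet> (y - x) \<le> norm z * norm (y - x)" by (rule norm_cauchy_schwarz)
      also have "\<dots> \<le> R * e" using R z n by (intro mult_mono) auto
      also have "\<dots> = r - mnorm D (x - P)" using R by (simp add: e_def)
      finally show ?thesis using mnorm_D_ge[OF z, of "x - P"] by (simp add: inner_diff_right)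
    qed
    then show "y \<in> mball D P r" by (simp add: mball_def mnorm_D_le_iff)
  qed
  moreover have "e > 0" using assms R by (simp add: e_def)
  ultimately show ?thesis by (auto simp: mem_interior_cball)
qed

lemma inner_le_mball: "x \<in> mball D P r \<Longrightarrow> \<bar>a \<bullet> (x - P)\<bar> \<le> r * mnorm B a"
proof -
  assume "x \<in> mball D P r"
  then have x: "mnorm D (x - P) \<le> r" by (simp add: mball_def)
  have "0 \<le> mnorm B a" using mnorm_ge[of 0 a] zero_D interior_subset by auto
  then have *: "mnorm B a * mnorm D (x - P) \<le> r * mnorm B a"
    using x by (metis mult.commute mult_left_mono)
  show ?thesis
    using Hoelder[of a "x - P"] Hoelder[of "- a" "x - P"] * by (simp add: mnorm_minus)
qed

text \<open>From an interior point one can still move a little along \<open>a\<close> and along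
  \<open>- a\<close>; one of the two moves enlarges the absolute value, so the bound for the ball is
  strict here.\<close>

lemma inner_less_interior_mball:
  assumes "a \<noteq> 0" "x \<in> interior (mball D P r)"
  shows "\<bar>a \<bullet> (x - P)\<bar> < r * mnorm B a"
proof -
  obtain e where e: "e > 0" "cball x e \<subseteq> mball D P r"
    using assms(2) by (auto simp: mem_interior_cball)
  define u where "u = (e / norm a) *\<^sub>R a"
  have u: "a \<bullet> u > 0" using e assms(1) by (simp add: u_def)
  have "x + u \<in> mball D P r" "x - u \<in> mball D P r"
    using e assms(1) by (auto simp: u_def dist_norm intro!: subsetD[OF e(2)])
  from this[THEN inner_le_mball, of a] show ?thesis
    using u by (simp add: inner_diff_right inner_add_right)
qed

lemma tangent_mball_iff:
  assumes "a \<noteq> 0" "0 \<le> r"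
  shows "tangent_to {y. a \<bullet> y = c} (mball D P r) \<longleftrightarrow> \<bar>a \<bullet> P - c\<bar> = r * mnorm B a"
proof -
  have N: "mnorm B a > 0" using assms(1) by (rule mnorm_pos)
  obtain y where y: "y \<in> D" "y \<bullet> a = mnorm B a" by (rule mnorm_attained)
  \<comment> \<open>\<open>s\<close> is the signed distance from \<open>P\<close> to the hyperplane,
    and \<open>x\<close> is a nearest point: \<open>y\<close> is the element of \<open>D\<close> on
    which the functional \<open>a\<close> attains its norm.\<close>
  define s where "s = (c - a \<bullet> P) / mnorm B a"
  define x where "x = P + s *\<^sub>R y"
  have x: "a \<bullet> x = c" using N y by (simp add: x_def s_def inner_add_right inner_commute)
  have "z \<bullet> (s *\<^sub>R y) \<le> \<bar>s\<bar>" if "z \<in> B" for z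
  proof -
    have "z \<bullet> y \<le> 1" "(- z) \<bullet> y \<le> 1"
      using y(1) that sym_B unfolding dual_ball_def by blast+
    then have "\<bar>z \<bullet> y\<bar> \<le> 1" by simp
    then have "\<bar>s * (z \<bullet> y)\<bar> \<le> \<bar>s\<bar>" by (simp add: abs_mult mult_left_le)
    then show ?thesis by simp
  qed
  then have sx: "mnorm D (x - P) \<le> \<bar>s\<bar>" by (simp add: x_def mnorm_D_le_iff)
  have s: "\<bar>a \<bullet> P - c\<bar> = \<bar>s\<bar> * mnorm B a" using N by (simp add: s_def abs_minus_commute)
  show ?thesis
  proof
    assume t: "tangent_to {y. a \<bullet> y = c} (mball D P r)"
    then obtain w where w: "a \<bullet> w = c" "w \<in> mball D P r" by (auto simp: tangent_to_def)
    have "\<bar>a \<bullet> P - c\<bar> \<le> r * mnorm B a"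
      using inner_le_mball[OF w(2), of a] w(1) by (simp add: inner_diff_right abs_minus_commute)
    \<comment> \<open>Otherwise the nearest point \<open>x\<close> would be an interior point of the
      ball on the hyperplane.\<close>
    moreover have "\<not> \<bar>s\<bar> < r"
      using t x interior_mball[of x P r] sx by (auto simp: tangent_to_def)
    ultimately show "\<bar>a \<bullet> P - c\<bar> = r * mnorm B a" using s N by auto
  next
    assume eq: "\<bar>a \<bullet> P - c\<bar> = r * mnorm B a"
    then have "\<bar>s\<bar> = r" using s N by simp
    then have "x \<in> mball D P r" using sx by (simp add: mball_def)
    moreover have "w \<notin> interior (mball D P r)" if "a \<bullet> w = c" for w
      using inner_less_interior_mball[OF assms(1), of w P r] that eq
      by (auto simp: inner_diff_right abs_minus_commute)
    ultimately show "tangent_to {y. a \<bullet> y = c} (mball D P r)"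
      using x by (auto simp: tangent_to_def)
  qed
qed

text \<open>Exactly one nonnegative radius makes the ball tangent, so \<open>LEAST\<close> picks
  that one.\<close>

lemma mdist_hyperplane_eq:
  assumes "a \<noteq> 0"
  shows "mdist_hyperplane D P {y. a \<bullet> y = c} = \<bar>a \<bullet> P - c\<bar> / mnorm B a"
proof -
  have N: "mnorm B a > 0" using assms by (rule mnorm_pos)
  have "0 \<le> r \<and> tangent_to {y. a \<bullet> y = c} (mball D P r) \<longleftrightarrow> r = \<bar>a \<bullet> P - c\<bar> / mnorm B a" for r
  proof (cases "0 \<le> r")
    case True
    then show ?thesis using tangent_mball_iff[OF assms True, of c P] N by (auto simp: field_simps)
  next
    case False
    moreover have "0 \<le> \<bar>a \<bullet> P - c\<bar> / mnorm B a" using N by simp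
    ultimately show ?thesis by linarith
  qed
  then show ?thesis unfolding mdist_hyperplane_def by (auto intro: Least_equality)
qed

end

subsection \<open>A simplex and its polar with respect to the centroid\<close>

text \<open>Both sets are affine of the same dimension and the smaller one is nonempty.\<close>

lemma hyperplane_subset_imp_eq:
  fixes m n :: "'a::euclidean_space"
  assumes "m \<noteq> 0" "n \<noteq> 0" "{x. m \<bullet> x = c} \<subseteq> {x. n \<bullet> x = e}"
  shows "{x. m \<bullet> x = c} = {x. n \<bullet> x = e}"
proof (rule affine_dim_equal)
  have "m \<bullet> ((c / (m \<bullet> m)) *\<^sub>R m) = c" using assms(1) by simp
  then show "{x. m \<bullet> x = c} \<noteq> {}" by blast
qed (use assms in \<open>auto simp: affine_hyperplane\<close>)

text \<open>With the centroid as origin, the \<open>a i\<close> are the vertices of a simplex and the \<open>b i\<close> those of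
  its polar; \<open>b i\<close> is the vertex opposite to the facet polar to \<open>a i\<close>.\<close>

locale polar_pair =
  fixes I :: "'i set" and a b :: "'i \<Rightarrow> 'a::euclidean_space"
  assumes card_I: "card I = Suc DIM('a)"
    and inner_ab: "i \<in> I \<Longrightarrow> j \<in> I \<Longrightarrow> a i \<bullet> b j = (if i = j then - real DIM('a) else 1)"
begin


lemma finite_I: "finite I"
  using card_I by (simp add: card_ge_0_finite)

text \<open>The relations between \<open>a\<close> and \<open>b\<close> are symmetric, so each fact
  about one family transfers to the other.\<close>

lemma swapped: "polar_pair I b a"
  using card_I inner_ab by unfold_locales (auto simp: inner_commute)

text \<open>The matrix of the products \<open>a i \<bullet> b j\<close> is the all-ones matrix minus
  \<open>d + 1\<close> times the identity.\<close>

lemma inner_combination: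
  assumes "i \<in> I"
  shows "a i \<bullet> (\<Sum>j\<in>I. u j *\<^sub>R b j) = sum u I - (real DIM('a) + 1) * u i"
proof -
  have "a i \<bullet> (\<Sum>j\<in>I. u j *\<^sub>R b j) = (\<Sum>j\<in>I. u j - (if j = i then (real DIM('a) + 1) * u i else 0))"
    unfolding inner_sum_right
    by (rule sum.cong) (use assms in \<open>auto simp: inner_ab algebra_simps\<close>)
  also have "\<dots> = sum u I - (real DIM('a) + 1) * u i"
    using assms finite_I by (simp add: sum_subtractf)
  finally show ?thesis .
qed

lemma inj_b: "inj_on (\<lambda>i. G + b i) I"
proof (rule inj_onI)
  fix i j assume ij: "i \<in> I" "j \<in> I" "G + b i = G + b j"
  then have "a i \<bullet> b i = a i \<bullet> b j" by simp
  then show "i = j" using ij by (auto simp: inner_ab split: if_splits)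
qed

text \<open>In an affine dependence the coefficients sum to 0, so pairing it with \<open>a i\<close>
  isolates the \<open>i\<close>-th coefficient.\<close>

lemma affine_independent_b: "\<not> affine_dependent ((\<lambda>i. G + b i) ` I)"
proof
  assume "affine_dependent ((\<lambda>i. G + b i) ` I)"
  then obtain U i where U: "sum U ((\<lambda>i. G + b i) ` I) = 0" and i: "i \<in> I" "U (G + b i) \<noteq> 0"
    and "(\<Sum>v\<in>(\<lambda>i. G + b i) ` I. U v *\<^sub>R v) = 0"
    using finite_I by (auto simp: affine_dependent_explicit_finite)
  then have 0: "(\<Sum>j\<in>I. U (G + b j) *\<^sub>R (G + b j)) = 0"
    by (simp add: sum.reindex[OF inj_b])
  have s: "(\<Sum>j\<in>I. U (G + b j)) = 0"
    using U by (simp add: sum.reindex[OF inj_b])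
  have "(\<Sum>j\<in>I. U (G + b j) *\<^sub>R b j) = 0"
    using 0 s by (simp add: scaleR_add_right sum.distrib flip: scaleR_left.sum)
  then have "(real DIM('a) + 1) * U (G + b i) = 0"
    using inner_combination[OF i(1), of "\<lambda>j. U (G + b j)"] s by simp
  then show False using i by auto
qed

lemma affine_hull_b: "affine hull (b ` I) = UNIV"
proof -
  have "\<not> affine_dependent (b ` I)" using affine_independent_b[of 0] by simp
  moreover have "card (b ` I) = DIM('a) + 1"
    using card_image[OF inj_b[of 0]] card_I by simp
  ultimately show ?thesis by (simp add: affine_independent_span_eq)
qed

lemma orthogonal_b_imp_zero:
  assumes "\<And>i. i \<in> I \<Longrightarrow> x \<bullet> b i = 0"
  shows "x = 0"
proof -
  have "affine hull (b ` I) \<subseteq> {y. x \<bullet> y = 0}"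
    by (rule hull_minimal) (use assms in \<open>auto simp: affine_hyperplane\<close>)
  then have "x \<bullet> x = 0" unfolding affine_hull_b by blast
  then show ?thesis by simp
qed

lemma orthogonal_a_imp_zero:
  assumes "\<And>i. i \<in> I \<Longrightarrow> a i \<bullet> x = 0"
  shows "x = 0"
  using polar_pair.orthogonal_b_imp_zero[OF swapped, of x] assms by (simp add: inner_commute)

text \<open>Each \<open>a i\<close> has the product \<open>- d + d * 1 = 0\<close> with the sum.
  This places the centroid of the polar at the origin.\<close>

lemma sum_b: "sum b I = 0"
proof (rule orthogonal_a_imp_zero)
  fix i assume "i \<in> I"
  from inner_combination[OF this, of "\<lambda>_. 1"] show "a i \<bullet> sum b I = 0"
    by (simp add: card_I)
qed

lemma sum_a: "sum a I = 0"
  using polar_pair.sum_b[OF swapped] .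

lemma sum_slack: "(\<Sum>i\<in>I. 1 - a i \<bullet> x) = real DIM('a) + 1"
proof -
  have "(\<Sum>i\<in>I. a i \<bullet> x) = 0" by (simp add: sum_a flip: inner_sum_left)
  then show ?thesis by (simp add: sum_subtractf card_I)
qed

text \<open>Both sides have the same product with every \<open>a i\<close>. Together with
  \<open>sum_slack\<close> this identifies the coefficients as barycentric coordinates.\<close>

lemma expansion: "x = (\<Sum>j\<in>I. ((1 - a j \<bullet> x) / (real DIM('a) + 1)) *\<^sub>R b j)" (is "x = ?s")
proof -
  have "x - ?s = 0"
  proof (rule orthogonal_a_imp_zero)
    fix i assume i: "i \<in> I"
    have "(\<Sum>j\<in>I. (1 - a j \<bullet> x) / (real DIM('a) + 1)) = 1"
      by (simp add: sum_slack flip: sum_divide_distrib)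
    then show "a i \<bullet> (x - ?s) = 0"
      using inner_combination[OF i, of "\<lambda>j. (1 - a j \<bullet> x) / (real DIM('a) + 1)"]
      by (simp add: inner_diff_right)
  qed
  then show ?thesis by simp
qed

lemma a_nonzero: "i \<in> I \<Longrightarrow> a i \<noteq> 0"
  using inner_ab[of i i] by auto

end

section \<open>Barycentric coordinates and facets of the polar simplex\<close>

locale minkowski_polar_pair = polar_pair I a b + minkowski_ball B
  for I :: "'i set" and a b :: "'i \<Rightarrow> 'a::euclidean_space" and B :: "'a set" +
  fixes G :: 'a
  assumes dim: "2 \<le> DIM('a)"
begin

abbreviation S :: "'a set" where "S \<equiv> convex hull ((\<lambda>i. G + b i) ` I)"

text \<open>Divided by \<open>d + 1\<close>, the slacks are the barycentric coordinates of \<open>p\<close> in \<open>S\<close>.\<close>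

definition slack where "slack i p = 1 - a i \<bullet> (p - G)"

abbreviation h where "h i \<equiv> mnorm B (a i)"

lemma sum_slack_eq: "(\<Sum>i\<in>I. slack i p) = real DIM('a) + 1"
  using sum_slack unfolding slack_def .

lemma slack_expansion: "p = (\<Sum>j\<in>I. (slack j p / (real DIM('a) + 1)) *\<^sub>R (G + b j))"
proof -
  have "(\<Sum>j\<in>I. slack j p / (real DIM('a) + 1)) = 1"
    by (simp add: sum_slack_eq flip: sum_divide_distrib)
  then show ?thesis
    using expansion[of "p - G"]
    by (simp add: slack_def scaleR_add_right sum.distrib flip: scaleR_left.sum)
qed

lemma slack_b: "i \<in> I \<Longrightarrow> j \<in> I \<Longrightarrow> slack i (G + b j) = (if i = j then real DIM('a) + 1 else 0)"
  by (simp add: slack_def inner_ab)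

lemma h_pos: "i \<in> I \<Longrightarrow> 0 < h i"
  by (simp add: mnorm_pos a_nonzero)

text \<open>Points with prescribed barycentric coordinates exist; this yields an interior point on
  the bisectors and the centers of exballs.\<close>

lemma slack_pointI:
  assumes "(\<Sum>i\<in>I. s i) = real DIM('a) + 1"
  obtains p where "\<And>i. i \<in> I \<Longrightarrow> slack i p = s i"
proof
  fix i assume i: "i \<in> I"
  show "slack i (G + (\<Sum>j\<in>I. (s j / (real DIM('a) + 1)) *\<^sub>R b j)) = s i"
    using assms by (simp add: slack_def inner_combination[OF i] flip: sum_divide_distrib)
qed

lemma slack_affine:
  "slack i (x + t *\<^sub>R (y - x)) = (1 - t) * slack i x + t * slack i y"
  by (simp add: slack_def algebra_simps)

lemma slack_convex_combination:
  "slack i ((1 - t) *\<^sub>R x + t *\<^sub>R y) = (1 - t) * slack i x + t * slack i y"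
  by (simp add: slack_def algebra_simps)

lemma slack_inject:
  assumes "\<And>i. i \<in> I \<Longrightarrow> slack i p = slack i q"
  shows "p = q"
proof -
  have "p - q = 0"
    by (rule orthogonal_a_imp_zero) (use assms in \<open>auto simp: slack_def algebra_simps\<close>)
  then show ?thesis by simp
qed

lemma hyperplane_conv: "{p. slack i p = 0} = {p. a i \<bullet> p = 1 + a i \<bullet> G}"
  by (auto simp: inner_diff_right slack_def)

lemma affine_slack: "affine {p. slack i p = 0}"
  by (simp add: hyperplane_conv affine_hyperplane)

text \<open>Nonnegative slacks, divided by \<open>d + 1\<close>, are the weights of a convex
  combination of the vertices.\<close>

lemma simplex_eq: "S = {p. \<forall>i\<in>I. 0 \<le> slack i p}"
proof
  have "convex {p. 0 \<le> slack i p}" for i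
    using convex_halfspace_le[of "a i" "1 + a i \<bullet> G"] by (simp add: slack_def algebra_simps)
  moreover have "{p. \<forall>i\<in>I. 0 \<le> slack i p} = (\<Inter>i\<in>I. {p. 0 \<le> slack i p})" by auto
  ultimately have "convex {p. \<forall>i\<in>I. 0 \<le> slack i p}" by (auto intro: convex_INT)
  then show "S \<subseteq> {p. \<forall>i\<in>I. 0 \<le> slack i p}"
    by (intro hull_minimal) (auto simp: slack_b)
  show "{p. \<forall>i\<in>I. 0 \<le> slack i p} \<subseteq> S"
  proof safe
    fix p assume p: "\<forall>i\<in>I. 0 \<le> slack i p"
    have "(\<Sum>j\<in>I. slack j p / (real DIM('a) + 1)) = 1"
      by (simp add: sum_slack_eq flip: sum_divide_distrib)
    then have "(\<Sum>j\<in>I. (slack j p / (real DIM('a) + 1)) *\<^sub>R (G + b j)) \<in> S"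
      using p finite_I by (intro convex_sum) (auto intro: hull_inc)
    then show "p \<in> S" using slack_expansion[of p] by simp
  qed
qed

lemma interior_eq: "interior S = {p. \<forall>i\<in>I. 0 < slack i p}"
proof -
  have eq: "{p. 0 \<le> slack i p} = {p. a i \<bullet> p \<le> 1 + a i \<bullet> G}" for i
    by (auto simp: slack_def algebra_simps)
  have "S = (\<Inter>i\<in>I. {p. 0 \<le> slack i p})" unfolding simplex_eq by auto
  also have "interior \<dots> = (\<Inter>i\<in>I. interior {p. 0 \<le> slack i p})"
    \<comment> \<open>Interior commutes with finite intersections.\<close>
    using finite_I by (induction I rule: finite_induct) auto
  also have "\<dots> = {p. \<forall>i\<in>I. 0 < slack i p}"
    unfolding eq by (auto simp: a_nonzero slack_def algebra_simps)
  finally show ?thesis .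
qed

lemma verts_eq: "verts S = (\<lambda>i. G + b i) ` I"
  by (simp add: verts_def extreme_point_of_convex_hull_affine_independent affine_independent_b)

lemma centroid_eq: "simplex_centroid S = G"
proof -
  have "(\<Sum>v\<in>verts S. v) = (\<Sum>i\<in>I. G + b i)" by (simp add: verts_eq sum.reindex[OF inj_b])
  also have "\<dots> = (real DIM('a) + 1) *\<^sub>R G"
    by (simp add: sum.distrib sum_b sum_constant_scaleR card_I add.commute)
  finally show ?thesis by (simp add: simplex_centroid_def add_nonneg_eq_0_iff)
qed

lemma verts_diff: "A \<subseteq> I \<Longrightarrow> verts S - (\<lambda>i. G + b i) ` A = (\<lambda>i. G + b i) ` (I - A)"
  by (simp add: verts_eq inj_on_image_set_diff[OF inj_b])

text \<open>The \<open>d\<close> vertices other than \<open>G + b i\<close> have \<open>i\<close>-th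
  slack 0 and are affinely independent, so their affine hull has the dimension of the hyperplane
  containing it.\<close>

lemma facet_hyperplane_eq:
  assumes i: "i \<in> I"
  shows "facet_hyperplane S (G + b i) = {p. slack i p = 0}"
proof -
  have V: "verts S - {G + b i} = (\<lambda>i. G + b i) ` (I - {i})"
    using verts_diff[of "{i}"] i by simp
  let ?V = "(\<lambda>i. G + b i) ` (I - {i})"
  have indep: "\<not> affine_dependent ?V"
    by (rule affine_independent_subset[OF affine_independent_b]) blast
  have "card ?V = card (I - {i})"
    by (rule card_image) (rule inj_on_subset[OF inj_b], blast)
  then have card: "card ?V = DIM('a)" using i finite_I card_I by simp
  have "affine hull ?V = {p. slack i p = 0}"
  proof (rule affine_dim_equal)
    show "aff_dim (affine hull ?V) = aff_dim {p. slack i p = 0}"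
      using aff_dim_affine_independent[OF indep] card a_nonzero[OF i]
      by (simp add: hyperplane_conv of_nat_diff)
    show "affine hull ?V \<noteq> {}" using card DIM_positive[where 'a='a] by (metis affine_hull_eq_empty card.empty less_irrefl)
    show "affine hull ?V \<subseteq> {p. slack i p = 0}"
      by (rule hull_minimal) (use i in \<open>auto simp: slack_b affine_slack\<close>)
  qed (auto simp: hyperplane_conv affine_hyperplane)
  then show ?thesis by (simp add: facet_hyperplane_def opposite_facet_def V)
qed

lemma mdist_facet:
  assumes "i \<in> I"
  shows "mdist_hyperplane D p {p. slack i p = 0} = \<bar>slack i p\<bar> / h i"
  unfolding hyperplane_conv mdist_hyperplane_eq[OF a_nonzero[OF assms]]
  by (simp add: slack_def inner_diff_right algebra_simps abs_minus_commute)

lemma tangent_facet_iff: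
  assumes "i \<in> I" "0 \<le> r"
  shows "tangent_to {p. slack i p = 0} (mball D c r) \<longleftrightarrow> \<bar>slack i c\<bar> = r * h i"
proof -
  have "\<bar>a i \<bullet> c - (1 + a i \<bullet> G)\<bar> = \<bar>slack i c\<bar>"
    by (simp add: slack_def inner_diff_right abs_minus_commute algebra_simps)
  then show ?thesis
    unfolding hyperplane_conv tangent_mball_iff[OF a_nonzero[OF assms(1)] assms(2)] by simp
qed

lemma mheight_eq:
  assumes "i \<in> I"
  shows "mheight D S (G + b i) = (real DIM('a) + 1) / h i"
  using assms by (simp add: mheight_def facet_hyperplane_eq mdist_facet slack_b)

subsection \<open>Bisectors, incenter and exballs\<close>

text \<open>Signed facet distances are compared, without absolute values; this selects the bisector
  through the interior of the simplex. The exterior one has a minus sign on one side.\<close>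

definition bisector where "bisector i j = {p. slack i p / h i = slack j p / h j}"

definition medial where "medial i j = {p. slack i p = slack j p}"

text \<open>The common form to which each of the six conditions is reduced.\<close>

definition equal_norms where "equal_norms \<longleftrightarrow> (\<forall>i\<in>I. \<forall>j\<in>I. h i = h j)"

lemma slack_G: "slack i G = 1"
  by (simp add: slack_def)

lemma G_in_bisector_iff:
  assumes "i \<in> I" "j \<in> I"
  shows "G \<in> bisector i j \<longleftrightarrow> h i = h j"
  using h_pos[OF assms(1)] h_pos[OF assms(2)] by (simp add: bisector_def slack_G)

lemma bisector_eq_hyperplane:
  assumes "i \<in> I" "j \<in> I" "i \<noteq> j"
  obtains m e where "m \<noteq> 0" "bisector i j = {p. m \<bullet> p = e}"
proof
  let ?m = "a i /\<^sub>R h i - a j /\<^sub>R h j"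
  \<comment> \<open>The product is \<open>- d / h i - 1 / h j\<close>.\<close>
  have "?m \<bullet> b i < 0"
    using assms h_pos[of i] h_pos[of j]
    by (simp add: inner_diff_left inner_ab) (smt (verit) mult_nonneg_nonneg of_nat_0_le_iff positive_imp_inverse_positive)
  then show "?m \<noteq> 0" by auto
  show "bisector i j = {p. ?m \<bullet> p = ?m \<bullet> G + 1 / h i - 1 / h j}"
    using h_pos[of i] h_pos[of j] assms
    by (auto simp: bisector_def slack_def inner_diff_left inner_diff_right
        diff_divide_distrib divide_inverse algebra_simps)
qed

lemma medial_eq_hyperplane: "medial i j = {p. (a i - a j) \<bullet> p = (a i - a j) \<bullet> G}"
  by (auto simp: medial_def slack_def inner_diff_left inner_diff_right)

lemma a_diff_nonzero:
  assumes "i \<in> I" "j \<in> I" "i \<noteq> j"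
  shows "a i - a j \<noteq> 0"
  using inner_ab[of i i] inner_ab[of j i] assms by auto

text \<open>A bisecting hyperplane is covered by \<open>bisector i j\<close> and the exterior bisector, which misses
  the interior; near an interior point it therefore lies in \<open>bisector i j\<close>, hence it does so
  everywhere.\<close>

lemma interior_bisector_imp:
  assumes ij: "i \<in> I" "j \<in> I" "i \<noteq> j"
    and bis: "is_bisector D {p. slack i p = 0} {p. slack j p = 0} H"
    and x0: "x0 \<in> H" "x0 \<in> interior S"
  shows "H = bisector i j"
proof -
  have hi: "h i > 0" "h j > 0" using ij by (auto simp: h_pos)
  obtain n c where n: "n \<noteq> 0" "H = {p. n \<bullet> p = c}"
    using bis by (auto simp: is_bisector_def is_hyperplane_def)
  have eq: "\<bar>slack i p\<bar> / h i = \<bar>slack j p\<bar> / h j" if "p \<in> H" for p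
    using bis that ij by (simp add: is_bisector_def mdist_facet)
  define f where "f p = slack i p / h i - slack j p / h j" for p
  have f_affine: "f (x + t *\<^sub>R (y - x)) = (1 - t) * f x + t * f y" for x y t
    unfolding f_def slack_affine by (simp add: add_divide_distrib right_diff_distrib)
  have f_iff: "p \<in> bisector i j \<longleftrightarrow> f p = 0" for p
    by (auto simp: f_def bisector_def)
  have f_int: "f p = 0" if "p \<in> H" "p \<in> interior S" for p
    using eq[OF that(1)] that(2) ij by (simp add: interior_eq f_def abs_of_pos)
  have "H \<subseteq> bisector i j"
  proof
    fix x assume x: "x \<in> H"
    obtain e where e: "e > 0" "ball x0 e \<subseteq> interior S"
      using x0(2) open_contains_ball[of "interior S"] by auto
    \<comment> \<open>A step small enough to stay in the ball around \<open>x0\<close>; the added 1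
      covers the case \<open>x = x0\<close>.\<close>
    define t where "t = e / (2 * (norm (x - x0) + 1))"
    have den: "norm (x - x0) + 1 > 0" by (simp add: add_nonneg_pos)
    have t: "t > 0" using e den by (simp add: t_def)
    have "t * norm (x - x0) \<le> t * (norm (x - x0) + 1)" using t by simp
    also have "\<dots> = e / 2" using den by (simp add: t_def field_simps)
    also have "\<dots> < e" using e by simp
    finally have "x0 + t *\<^sub>R (x - x0) \<in> ball x0 e" using t by (simp add: dist_norm)
    then have "x0 + t *\<^sub>R (x - x0) \<in> interior S" using e by blast
    moreover have "x0 + t *\<^sub>R (x - x0) \<in> H"
      using x x0(1) by (simp add: n(2) inner_diff_right inner_add_right)
    ultimately have "f (x0 + t *\<^sub>R (x - x0)) = 0" by (intro f_int)
    moreover have "f x0 = 0" using x0 by (rule f_int)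
    \<comment> \<open>\<open>f\<close> is affine on the line through \<open>x0\<close> and
      \<open>x\<close> and vanishes at the parameters 0 and \<open>t > 0\<close>, hence also at
      1.\<close>
    ultimately show "x \<in> bisector i j" using t by (simp add: f_affine f_iff)
  qed
  moreover obtain m e where "m \<noteq> 0" "bisector i j = {p. m \<bullet> p = e}"
    using bisector_eq_hyperplane[OF ij] by blast
  ultimately show ?thesis using n hyperplane_subset_imp_eq by metis
qed

lemma sum_h_pos: "0 < sum h I"
  using h_pos card_I by (intro sum_pos finite_I) auto

lemma interior_bisectors_eq:
  "interior_bisectors D S = {bisector i j | i j. i \<in> I \<and> j \<in> I \<and> i \<noteq> j}" (is "_ = ?R")
proof (intro subset_antisym subsetI)
  fix H assume "H \<in> interior_bisectors D S"
  then obtain i j x0 where "x0 \<in> H" "x0 \<in> interior S" "i \<in> I" "j \<in> I" "i \<noteq> j"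
    "is_bisector D {p. slack i p = 0} {p. slack j p = 0} H"
    by (auto simp: interior_bisectors_def verts_eq facet_hyperplane_eq)
  then show "H \<in> ?R" using interior_bisector_imp by blast
next
  fix H assume "H \<in> ?R"
  then obtain i j where ij: "i \<in> I" "j \<in> I" "i \<noteq> j" and H: "H = bisector i j" by blast
  have "is_hyperplane H"
    using bisector_eq_hyperplane[OF ij] unfolding is_hyperplane_def H by metis
  moreover have "\<bar>slack i p\<bar> / h i = \<bar>slack j p\<bar> / h j" if "p \<in> H" for p
  proof -
    have "\<bar>slack i p / h i\<bar> = \<bar>slack j p / h j\<bar>" using that by (simp add: H bisector_def)
    then show ?thesis using ij h_pos by (simp add: abs_of_pos)
  qed
  ultimately have "is_bisector D {p. slack i p = 0} {p. slack j p = 0} H"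
    using ij by (simp add: is_bisector_def mdist_facet)
  moreover have "H \<inter> interior S \<noteq> {}"
  proof -
    \<comment> \<open>Slacks proportional to the \<open>h i\<close>, normalized to the sum
      \<open>d + 1\<close>, describe the incenter: it is interior and lies on every
      \<open>bisector i j\<close>.\<close>
    have "(\<Sum>i\<in>I. (real DIM('a) + 1) * h i / sum h I) = real DIM('a) + 1"
      using sum_h_pos by (simp flip: sum_distrib_left sum_divide_distrib)
    then obtain p where p: "\<And>i. i \<in> I \<Longrightarrow> slack i p = (real DIM('a) + 1) * h i / sum h I"
      by (rule slack_pointI) blast
    have "p \<in> interior S" using h_pos sum_h_pos by (auto simp: interior_eq p)
    moreover have "p \<in> H" using h_pos[OF ij(1)] h_pos[OF ij(2)] by (simp add: H bisector_def p ij)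
    ultimately show ?thesis by blast
  qed
  moreover have "b i \<noteq> b j" using ij inj_b[of 0] by (auto dest: inj_onD)
  ultimately show "H \<in> interior_bisectors D S"
    unfolding interior_bisectors_def verts_eq using ij
    by (intro CollectI conjI bexI[of _ "G + b i"] bexI[of _ "G + b j"])
      (auto simp: facet_hyperplane_eq)
qed

text \<open>Since the \<open>b k\<close> sum to 0, such a hyperplane must pass through
  \<open>G\<close>. Its normal is then known on all \<open>b k\<close> up to one factor, which makes
  it a multiple of \<open>a i - a j\<close>.\<close>

lemma quasi_medial_imp:
  assumes ij: "i \<in> I" "j \<in> I" "i \<noteq> j" and m: "m \<noteq> 0"
    and k: "\<And>k. k \<in> I \<Longrightarrow> k \<noteq> i \<Longrightarrow> k \<noteq> j \<Longrightarrow> m \<bullet> (G + b k) = e"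
    and mid: "m \<bullet> midpoint (G + b i) (G + b j) = e"
  shows "{p. m \<bullet> p = e} = medial i j"
proof -
  define c where "c = e - m \<bullet> G"
  have bk: "m \<bullet> b k = c" if "k \<in> I - {i, j}" for k
    using k[of k] that by (simp add: c_def inner_add_right algebra_simps)
  have bij: "m \<bullet> b i + m \<bullet> b j = 2 * c"
    using mid by (simp add: c_def midpoint_def inner_add_right algebra_simps)
  have "0 = (\<Sum>k\<in>I. m \<bullet> b k)" by (simp add: sum_b flip: inner_sum_right)
  also have "\<dots> = (\<Sum>k\<in>I - {i, j}. m \<bullet> b k) + (m \<bullet> b i + m \<bullet> b j)"
    using ij finite_I by (subst sum.subset_diff[of "{i, j}"]) auto
  also have "(\<Sum>k\<in>I - {i, j}. m \<bullet> b k) = (\<Sum>k\<in>I - {i, j}. c)" by (rule sum.cong) (auto simp: bk)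
  also have "\<dots> = (real DIM('a) - 1) * c"
    using ij finite_I dim by (simp add: card_Diff_subset card_I of_nat_diff)
  \<comment> \<open>The \<open>d - 1\<close> remaining vertices contribute \<open>c\<close> each and
    the midpoint condition contributes \<open>2 * c\<close>.\<close>
  finally have "(real DIM('a) + 1) * c = 0" using bij by (simp add: algebra_simps)
  then have c: "c = 0" by (simp add: add_nonneg_eq_0_iff)
  \<comment> \<open>The factor is found by pairing with \<open>b j\<close>, where
    \<open>a i - a j\<close> takes the value \<open>d + 1\<close>.\<close>
  define t where "t = (m \<bullet> b j) / (real DIM('a) + 1)"
  have "m - t *\<^sub>R (a i - a j) = 0"
  proof (rule orthogonal_b_imp_zero)
    fix k assume kI: "k \<in> I"
    have t': "t * (real DIM('a) + 1) = m \<bullet> b j" by (simp add: t_def)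
    consider "k = i" | "k = j" | "k \<in> I - {i, j}" using kI by blast
    then show "(m - t *\<^sub>R (a i - a j)) \<bullet> b k = 0"
      using ij t' bij c bk[of k]
      by cases (auto simp: inner_diff_left inner_ab algebra_simps)
  qed
  then have mt: "m = t *\<^sub>R (a i - a j)" by simp
  then have "t \<noteq> 0" using m by auto
  moreover have "e = m \<bullet> G" using c by (simp add: c_def)
  ultimately show ?thesis by (simp add: mt medial_eq_hyperplane)
qed

lemma quasi_medial_hyperplanes_eq:
  "quasi_medial_hyperplanes S = {medial i j | i j. i \<in> I \<and> j \<in> I \<and> i \<noteq> j}" (is "_ = ?R")
proof (intro subset_antisym subsetI)
  fix H assume "H \<in> quasi_medial_hyperplanes S"
  then obtain i j where ij: "i \<in> I" "j \<in> I" "i \<noteq> j" and H: "is_hyperplane H"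
    and sub: "convex hull (verts S - {G + b i, G + b j}) \<subseteq> H"
    and mid: "midpoint (G + b i) (G + b j) \<in> H"
    by (auto simp: quasi_medial_hyperplanes_def verts_eq)
  obtain m e where m: "m \<noteq> 0" "H = {p. m \<bullet> p = e}" using H by (auto simp: is_hyperplane_def)
  have "G + b k \<in> H" if "k \<in> I" "k \<noteq> i" "k \<noteq> j" for k
  proof -
    have "G + b k \<in> (\<lambda>i. G + b i) ` (I - {i, j})" using that by blast
    also have "\<dots> = verts S - {G + b i, G + b j}" using verts_diff[of "{i, j}"] ij by simp
    finally show ?thesis using sub by (blast intro: hull_inc)
  qed
  then have "H = medial i j"
    using quasi_medial_imp[OF ij m(1), of e] mid unfolding m(2) by blast
  then show "H \<in> ?R" using ij by blast
next
  fix H assume "H \<in> ?R"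
  then obtain i j where ij: "i \<in> I" "j \<in> I" "i \<noteq> j" and H: "H = medial i j" by blast
  have hyp: "is_hyperplane H"
    using a_diff_nonzero[OF ij] unfolding is_hyperplane_def H medial_eq_hyperplane by blast
  have "verts S - {G + b i, G + b j} = (\<lambda>i. G + b i) ` (I - {i, j})"
    using verts_diff[of "{i, j}"] ij by simp
  also have "\<dots> \<subseteq> H" using ij by (auto simp: H medial_def slack_b)
  finally have "convex hull (verts S - {G + b i, G + b j}) \<subseteq> H"
    unfolding H medial_eq_hyperplane by (intro hull_minimal convex_hyperplane)
  moreover have "midpoint (G + b i) (G + b j) \<in> H"
    using ij by (simp add: H medial_eq_hyperplane midpoint_def inner_add_right inner_diff_left inner_ab algebra_simps)
  moreover have "b i \<noteq> b j" using ij inj_b[of 0] by (auto dest: inj_onD)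
  ultimately show "H \<in> quasi_medial_hyperplanes S"
    unfolding quasi_medial_hyperplanes_def verts_eq using ij hyp
    by (intro CollectI conjI bexI[of _ "G + b i"] bexI[of _ "G + b j"]) auto
qed

lemma bisector_eq_medial:
  assumes "equal_norms" "i \<in> I" "j \<in> I"
  shows "bisector i j = medial i j"
proof -
  have "h j = h i" using assms unfolding equal_norms_def by blast
  then show ?thesis using h_pos[OF assms(2)] by (simp add: bisector_def medial_def)
qed

lemma equal_normsI:
  assumes "\<And>i j. i \<in> I \<Longrightarrow> j \<in> I \<Longrightarrow> i \<noteq> j \<Longrightarrow> G \<in> bisector i j"
  shows "equal_norms"
  unfolding equal_norms_def using assms G_in_bisector_iff by blast

text \<open>All slacks of \<open>G\<close> are 1, so \<open>G\<close> lies on every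
  \<open>medial k l\<close>, but on \<open>bisector i j\<close> only if
  \<open>h i = h j\<close>.\<close>

lemma quasi_medial_iff:
  "quasi_medial_hyperplanes S = interior_bisectors D S \<longleftrightarrow> equal_norms"
proof
  assume eq: "quasi_medial_hyperplanes S = interior_bisectors D S"
  show "equal_norms"
  proof (rule equal_normsI)
    fix i j assume "i \<in> I" "j \<in> I" "i \<noteq> j"
    then have "bisector i j \<in> quasi_medial_hyperplanes S"
      unfolding eq interior_bisectors_eq by blast
    \<comment> \<open>The pair \<open>k\<close>, \<open>l\<close> may differ from \<open>i\<close>,
      \<open>j\<close>; this is harmless, as \<open>G\<close> lies on all medial
      hyperplanes.\<close>
    then obtain k l where "bisector i j = medial k l" unfolding quasi_medial_hyperplanes_eq by blast
    then show "G \<in> bisector i j" by (simp add: medial_def slack_G)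
  qed
next
  assume eq: "equal_norms"
  have "H = medial i j \<and> i \<in> I \<and> j \<in> I \<and> i \<noteq> j \<longleftrightarrow> H = bisector i j \<and> i \<in> I \<and> j \<in> I \<and> i \<noteq> j"
    for H i j
    using bisector_eq_medial[OF eq, of i j] by auto
  then show "quasi_medial_hyperplanes S = interior_bisectors D S"
    unfolding quasi_medial_hyperplanes_eq interior_bisectors_eq by simp
qed

text \<open>For equal norms, a point on all bisectors has equal slacks; as these sum to
  \<open>d + 1\<close>, each is 1, which characterizes \<open>G\<close>.\<close>

lemma incenter_iff: "is_incenter D S G \<longleftrightarrow> equal_norms"
proof
  assume "is_incenter D S G"
  then have "G \<in> \<Inter> (interior_bisectors D S)" by (simp add: is_incenter_def)
  then show "equal_norms" unfolding interior_bisectors_eq by (intro equal_normsI) blast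
next
  assume eq: "equal_norms"
  have "\<Inter> (interior_bisectors D S) = {G}"
  proof (intro subset_antisym subsetI)
    fix p assume "p \<in> \<Inter> (interior_bisectors D S)"
    then have bis: "p \<in> bisector i j" if "i \<in> I" "j \<in> I" "i \<noteq> j" for i j
      using that unfolding interior_bisectors_eq by blast
    have same: "slack i p = slack j p" if "i \<in> I" "j \<in> I" for i j
    proof (cases "i = j")
      case False
      then have "p \<in> medial i j" using bis that bisector_eq_medial[OF eq] by simp
      then show ?thesis by (simp add: medial_def)
    qed simp
    have "slack i p = 1" if i: "i \<in> I" for i
    proof -
      have "real DIM('a) + 1 = (\<Sum>j\<in>I. slack j p)" by (simp add: sum_slack_eq)
      also have "\<dots> = (\<Sum>j\<in>I. slack i p)" by (rule sum.cong) (use same[OF _ i] in simp_all)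
      also have "\<dots> = (real DIM('a) + 1) * slack i p" by (simp add: card_I)
      finally have "real DIM('a) + 1 = (real DIM('a) + 1) * slack i p" .
      then show ?thesis by (simp only: mult_cancel_left1) (simp add: add_nonneg_eq_0_iff)
    qed
    then have "p = G" by (intro slack_inject) (simp add: slack_G)
    then show "p \<in> {G}" by simp
  next
    fix p assume "p \<in> {G}"
    then show "p \<in> \<Inter> (interior_bisectors D S)"
      using eq G_in_bisector_iff unfolding interior_bisectors_eq equal_norms_def by blast
  qed
  then show "is_incenter D S G" by (simp add: is_incenter_def)
qed

section \<open>Sides of facets and exballs\<close>

lemma same_side_iff:
  assumes "0 < slack i y"
  shows "same_side {p. slack i p = 0} x y \<longleftrightarrow> 0 < slack i x"
proof
  assume pos: "0 < slack i x"
  have "slack i z > 0" if "z \<in> closed_segment x y" for z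
  proof -
    from that obtain t where t: "0 \<le> t" "t \<le> 1" "z = (1 - t) *\<^sub>R x + t *\<^sub>R y"
      unfolding in_segment by iprover
    then have "slack i z = (1 - t) * slack i x + t * slack i y"
      by (simp only: slack_convex_combination)
    also have "\<dots> > 0"
    proof (cases "t = 0")
      case False
      then show ?thesis using t pos assms by (simp add: add_nonneg_pos)
    qed (use pos in simp)
    finally show ?thesis .
  qed
  then show "same_side {p. slack i p = 0} x y" unfolding same_side_def by fastforce
next
  assume s: "same_side {p. slack i p = 0} x y"
  show "0 < slack i x"
  proof (rule ccontr)
    assume n: "\<not> 0 < slack i x"
    \<comment> \<open>The slack is affine along the segment, and \<open>t\<close> is the parameter
      of its zero.\<close>
    define t where "t = slack i x / (slack i x - slack i y)"
    have t: "0 \<le> t" "t \<le> 1" using n assms by (auto simp: t_def field_simps)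
    have "(1 - t) * slack i x + t * slack i y = slack i x - t * (slack i x - slack i y)"
      by (simp add: algebra_simps)
    also have "\<dots> = 0" using n assms by (simp add: t_def)
    finally have "slack i ((1 - t) *\<^sub>R x + t *\<^sub>R y) = 0"
      by (simp only: slack_convex_combination)
    moreover have "(1 - t) *\<^sub>R x + t *\<^sub>R y \<in> closed_segment x y"
      using t by (auto simp: closed_segment_def)
    ultimately show False using s by (auto simp: same_side_def)
  qed
qed

lemma other_side_iff:
  assumes "0 < slack i y"
  shows "other_side {p. slack i p = 0} x y \<longleftrightarrow> slack i x < 0"
proof -
  have "other_side {p. slack i p = 0} x y \<longleftrightarrow>
      slack i x \<noteq> 0 \<and> \<not> same_side {p. slack i p = 0} x y"
    using assms by (auto simp: other_side_def same_side_def)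
  then show ?thesis using same_side_iff[OF assms] by auto
qed

lemma G_interior: "G \<in> interior S"
  by (simp add: interior_eq slack_G)

text \<open>Tangency fixes the absolute values of the slacks of the center, and the side conditions
  fix their signs.\<close>

lemma exball_iff:
  assumes i: "i \<in> I"
  shows "is_exball D S (G + b i) c r \<longleftrightarrow>
    0 < r \<and> slack i c = - (r * h i) \<and> (\<forall>j\<in>I - {i}. slack j c = r * h j)"
proof -
  have V: "verts S - {G + b i} = (\<lambda>i. G + b i) ` (I - {i})"
    using verts_diff[of "{i}"] i by simp
  \<comment> \<open>All interior points lie on the same side of each facet; \<open>G\<close> is one
    of them, so the quantifier is not vacuous.\<close>
  have other: "(\<forall>x\<in>interior S. other_side (facet_hyperplane S (G + b i)) c x) \<longleftrightarrow> slack i c < 0"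
    using G_interior i by (auto simp: facet_hyperplane_eq interior_eq other_side_iff)
  have same: "(\<forall>w\<in>verts S - {G + b i}. \<forall>x\<in>interior S. same_side (facet_hyperplane S w) c x) \<longleftrightarrow>
      (\<forall>j\<in>I - {i}. 0 < slack j c)"
    unfolding V using G_interior by (auto simp: facet_hyperplane_eq interior_eq same_side_iff)
  have tangent: "(\<forall>w\<in>verts S. tangent_to (facet_hyperplane S w) (mball D c r)) \<longleftrightarrow>
      (\<forall>j\<in>I. \<bar>slack j c\<bar> = r * h j)" if "0 < r"
    using that by (auto simp: verts_eq facet_hyperplane_eq tangent_facet_iff)
  show ?thesis
    unfolding is_exball_def other same
  proof (rule conj_cong, goal_cases)
    case 2
    have pos: "0 < r * h j" if "j \<in> I" for j using 2 h_pos[OF that] by simp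
    have neg_iff: "\<bar>s\<bar> = r * h j \<and> s < 0 \<longleftrightarrow> s = - (r * h j)"
      and pos_iff: "\<bar>s\<bar> = r * h j \<and> 0 < s \<longleftrightarrow> s = r * h j" if "j \<in> I" for s j
      using pos[OF that] by linarith+
    have "(\<forall>j\<in>I. P j) \<and> Q \<and> (\<forall>j\<in>I - {i}. R j) \<longleftrightarrow> (P i \<and> Q) \<and> (\<forall>j\<in>I - {i}. P j \<and> R j)"
      for P R Q using i by blast
    then show ?case
      by (simp add: tangent[OF 2] pos_iff) (use neg_iff[OF i, of "slack i c"] in blast)
  qed simp
qed

text \<open>The slacks of the center are \<open>r * h j\<close>, with a minus sign at
  \<open>i\<close>, and slacks sum to \<open>d + 1\<close>.\<close>

lemma exradius_eq:
  assumes i: "i \<in> I" and ex: "is_exball D S (G + b i) c r"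
  shows "r * (sum h I - 2 * h i) = real DIM('a) + 1"
proof -
  have "real DIM('a) + 1 = slack i c + (\<Sum>j\<in>I - {i}. slack j c)"
    using sum.remove[OF finite_I i, of "\<lambda>j. slack j c"] by (simp add: sum_slack_eq)
  also have "\<dots> = - (r * h i) + (\<Sum>j\<in>I - {i}. r * h j)"
    using ex i by (simp add: exball_iff)
  also have "\<dots> = r * (sum h I - 2 * h i)"
    using finite_I i by (simp add: sum_diff1 algebra_simps flip: sum_distrib_left)
  finally show ?thesis by simp
qed

lemma exradii_iff: "exradii_all_equal D S \<longleftrightarrow> equal_norms"
proof
  assume ex: "exradii_all_equal D S"
  show "equal_norms"
    unfolding equal_norms_def
  proof safe
    fix i j assume ij: "i \<in> I" "j \<in> I"
    then obtain c r c' r' where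
      e: "is_exball D S (G + b i) c r" "is_exball D S (G + b j) c' r'"
      using ex unfolding exradii_all_equal_def verts_eq by blast
    then have "r = r'"
      using ex ij unfolding exradii_all_equal_def exradii_def verts_eq by blast
    moreover have "0 < r" using e(1) by (simp add: is_exball_def)
    moreover have "r * (sum h I - 2 * h i) = r' * (sum h I - 2 * h j)"
      using exradius_eq[OF ij(1) e(1)] exradius_eq[OF ij(2) e(2)] by simp
    ultimately show "h i = h j" by simp
  qed
next
  assume eq: "equal_norms"
  have ex: "\<exists>c r. is_exball D S (G + b i) c r" if i: "i \<in> I" for i
  proof -
    \<comment> \<open>With all norms equal to \<open>h i\<close>, the slacks of an excenter sum to
      \<open>(d - 1) * r * h i\<close>, which has to be \<open>d + 1\<close>. The radius is positive
      because \<open>d\<close> is at least 2.\<close>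
    define r where "r = (real DIM('a) + 1) / ((real DIM('a) - 1) * h i)"
    have "real DIM('a) - 1 > 0" using dim by simp
    then have r: "r > 0" "r * h i * (real DIM('a) - 1) = real DIM('a) + 1"
      using h_pos[OF i] unfolding r_def by simp_all
    have "(\<Sum>j\<in>I. if j = i then - (r * h i) else r * h i)
        = (\<Sum>j\<in>I. r * h i - (if j = i then 2 * (r * h i) else 0))"
      by (rule sum.cong) auto
    also have "\<dots> = real DIM('a) + 1"
      using i finite_I r by (simp add: sum_subtractf card_I algebra_simps)
    finally obtain c where c: "\<And>j. j \<in> I \<Longrightarrow> slack j c = (if j = i then - (r * h i) else r * h i)"
      by (rule slack_pointI) blast
    have "slack j c = r * h j" if "j \<in> I - {i}" for j
    proof -
      have "h i = h j" using eq i that unfolding equal_norms_def by blast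
      then show ?thesis using that by (simp add: c)
    qed
    moreover have "slack i c = - (r * h i)" using c[OF i] by simp
    ultimately have "is_exball D S (G + b i) c r"
      unfolding exball_iff[OF i] using r(1) by blast
    then show ?thesis by blast
  qed
  have same: "r = s" if rs: "r \<in> exradii D S" "s \<in> exradii D S" for r s
  proof -
    obtain i where i: "i \<in> I" and r: "r * (sum h I - 2 * h i) = real DIM('a) + 1"
      using rs(1) exradius_eq unfolding exradii_def verts_eq by blast
    obtain j where j: "j \<in> I" and s: "s * (sum h I - 2 * h j) = real DIM('a) + 1"
      using rs(2) exradius_eq unfolding exradii_def verts_eq by blast
    have "h i = h j" using eq i j unfolding equal_norms_def by blast
    then have "(r - s) * (sum h I - 2 * h i) = 0" using r s by (simp add: left_diff_distrib)
    \<comment> \<open>The factor may be cancelled, since its product with \<open>r\<close> is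
      \<open>d + 1\<close>.\<close>
    moreover have "sum h I - 2 * h i \<noteq> 0"
    proof
      assume "sum h I - 2 * h i = 0"
      then have "real DIM('a) + 1 = 0" using r by simp
      then show False by simp
    qed
    ultimately show "r = s" by simp
  qed
  show "exradii_all_equal D S"
    unfolding exradii_all_equal_def verts_eq using ex same by auto
qed

lemma mheights_iff:
  "(\<forall>v\<in>verts S. \<forall>w\<in>verts S. mheight D S v = mheight D S w) \<longleftrightarrow> equal_norms"
proof -
  have "(real DIM('a) + 1) / h i = (real DIM('a) + 1) / h j \<longleftrightarrow> h i = h j"
    if "i \<in> I" "j \<in> I" for i j
    using h_pos[OF that(1)] h_pos[OF that(2)] by (auto simp: field_simps add_nonneg_eq_0_iff)
  then show ?thesis by (simp add: verts_eq equal_norms_def mheight_eq)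
qed

end

text \<open>A normal of the facet opposite to \<open>v\<close> is constant on the vectors
  \<open>w - G\<close> of that facet. Scaling makes this constant 1, and the zero sum then forces
  the value \<open>- d\<close> at \<open>v\<close>.\<close>

lemma polar_vertex_exists:
  fixes C :: "'a::euclidean_space set"
  assumes ind: "\<not> affine_dependent C" and card: "card C = Suc DIM('a)"
    and G: "(\<Sum>w\<in>C. w - G) = 0" and v: "v \<in> C"
  obtains y where "\<And>w. w \<in> C \<Longrightarrow> (w - G) \<bullet> y = (if w = v then - real DIM('a) else 1)"
proof -
  have fin: "finite C" using ind by (rule aff_independent_finite)
  have "\<not> affine_dependent (C - {v})" using ind by (rule affine_independent_subset) blast
  moreover have cd: "card (C - {v}) = DIM('a)" using fin v card by simp
  ultimately have "aff_dim (C - {v}) = DIM('a) - 1"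
    using aff_dim_affine_independent[of "C - {v}"] by (simp add: of_nat_diff)
  then obtain n c where n: "n \<noteq> 0" "affine hull (C - {v}) = {x. n \<bullet> x = c}"
    unfolding aff_dim_eq_hyperplane by blast
  have nw: "n \<bullet> w = c" if "w \<in> C - {v}" for w
    using that hull_inc[of w "C - {v}" affine] n(2) by blast
  define e where "e = c - n \<bullet> G"
  have "0 = (\<Sum>w\<in>C. (w - G) \<bullet> n)" by (simp add: G flip: inner_sum_left)
  also have "\<dots> = (v - G) \<bullet> n + (\<Sum>w\<in>C - {v}. (w - G) \<bullet> n)"
    using fin v by (rule sum.remove)
  also have "(\<Sum>w\<in>C - {v}. (w - G) \<bullet> n) = (\<Sum>w\<in>C - {v}. e)"
    by (rule sum.cong) (auto simp: nw e_def inner_diff_right inner_commute[of _ n])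
  finally have vn: "(v - G) \<bullet> n = - real DIM('a) * e" by (simp add: cd)
  \<comment> \<open>Otherwise the facet hyperplane would contain \<open>v\<close> too, although the
    affine hull of \<open>C\<close> is the whole space.\<close>
  have "e \<noteq> 0"
  proof
    assume "e = 0"
    then have "n \<bullet> v = c" using vn by (simp add: e_def inner_commute[of _ n] inner_diff_right)
    then have "C \<subseteq> {x. n \<bullet> x = c}" using nw by blast
    then have "affine hull C \<subseteq> {x. n \<bullet> x = c}" by (simp add: hull_minimal affine_hyperplane)
    then have "{x. n \<bullet> x = c} = UNIV" using affine_independent_span_eq[OF ind card] by blast
    then have "n \<bullet> 0 = c" "n \<bullet> n = c" by blast+
    then show False using n(1) by simp
  qed
  show thesis
  proof
    fix w assume w: "w \<in> C"
    have "(w - G) \<bullet> n = e" if "w \<noteq> v"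
      using nw[of w] w that by (simp add: e_def inner_commute[of _ n] inner_diff_right)
    then show "(w - G) \<bullet> (n /\<^sub>R e) = (if w = v then - real DIM('a) else 1)"
      using vn \<open>e \<noteq> 0\<close> by auto
  qed
qed

section \<open>Equivalence of the six conditions\<close>

theorem theorem4p3:
  fixes B T :: "'a::euclidean_space set"
  assumes dim: "2 \<le> DIM('a)"
    and B: "centered_convex_body B"
    and T: "int DIM('a) simplex T"
  defines "Bd \<equiv> dual_ball B"
    and "Td \<equiv> dual_body T (simplex_centroid T)"
  shows
    "(AG_quasiregular B T \<longleftrightarrow>
        (\<forall>v\<in>verts T. \<forall>w\<in>verts T. median_length B T v = median_length B T w)) \<and>
     (AG_quasiregular B T \<longleftrightarrow>
        (\<forall>v\<in>verts Td. \<forall>w\<in>verts Td. mheight Bd Td v = mheight Bd Td w)) \<and>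
     (AG_quasiregular B T \<longleftrightarrow> quasi_medial_hyperplanes Td = interior_bisectors Bd Td) \<and>
     (AG_quasiregular B T \<longleftrightarrow> is_incenter Bd Td (simplex_centroid Td)) \<and>
     (AG_quasiregular B T \<longleftrightarrow> exradii_all_equal Bd Td)"
proof -
  obtain C where ind: "\<not> affine_dependent C" and card: "card C = Suc DIM('a)"
    and TC: "T = convex hull C"
    using T by (auto simp: simplex_def)
  have fin: "finite C" using ind by (rule aff_independent_finite)
  have V: "verts T = C"
    by (simp add: verts_def TC extreme_point_of_convex_hull_affine_independent ind)
  define G where "G = simplex_centroid T"
  have sumC: "\<Sum>C = (real DIM('a) + 1) *\<^sub>R G"
    by (simp add: G_def simplex_centroid_def V add_nonneg_eq_0_iff)
  then have sum0: "(\<Sum>w\<in>C. w - G) = 0"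
    by (simp add: sum_subtractf sum_constant_scaleR card add.commute)
  have "\<forall>v\<in>C. \<exists>y. \<forall>w\<in>C. (w - G) \<bullet> y = (if w = v then - real DIM('a) else 1)"
    using polar_vertex_exists[OF ind card sum0] by metis
  then obtain b where b: "\<And>v w. v \<in> C \<Longrightarrow> w \<in> C \<Longrightarrow>
      (w - G) \<bullet> b v = (if w = v then - real DIM('a) else 1)"
    by metis
  \<comment> \<open>The vertices of \<open>T\<close> serve as their own indices.\<close>
  interpret minkowski_polar_pair C "\<lambda>v. v - G" b B G
    using B dim card b by unfold_locales auto
  \<comment> \<open>A linear inequality holds on \<open>T\<close> as soon as it holds at the
    vertices, so the polar is cut out by finitely many half-spaces and equals
    \<open>S\<close>.\<close>
  have "dual_body T G = {p. \<forall>v\<in>C. (v - G) \<bullet> (p - G) \<le> 1}"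
  proof (intro subset_antisym subsetI)
    fix p assume "p \<in> dual_body T G"
    then show "p \<in> {p. \<forall>v\<in>C. (v - G) \<bullet> (p - G) \<le> 1}"
      by (auto simp: dual_body_def TC hull_inc)
  next
    fix p assume p: "p \<in> {p. \<forall>v\<in>C. (v - G) \<bullet> (p - G) \<le> 1}"
    have conv: "(x - G) \<bullet> (p - G) = (p - G) \<bullet> x - (p - G) \<bullet> G" for x
      by (subst inner_commute) (rule inner_diff_right)
    have "T \<subseteq> {x. (p - G) \<bullet> x \<le> 1 + (p - G) \<bullet> G}"
      unfolding TC using p by (intro hull_minimal convex_halfspace_le) (auto simp: conv)
    then have "\<forall>x\<in>T. (x - G) \<bullet> (p - G) \<le> 1" by (auto simp: conv)
    moreover have "p = G + (p - G)" by simp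
    ultimately show "p \<in> dual_body T G" unfolding dual_body_def by blast
  qed
  then have Td: "Td = S" by (simp add: Td_def simplex_eq slack_def flip: G_def)
  have AG: "AG_quasiregular B T \<longleftrightarrow> equal_norms"
  proof -
    have "AG_quasiregular B T \<longleftrightarrow> (\<exists>r>0. \<forall>v\<in>C. h v = r)"
      by (auto simp: AG_quasiregular_def is_circumcenter_def V msphere_def simp flip: G_def)
    also have "\<dots> \<longleftrightarrow> equal_norms"
    proof -
      \<comment> \<open>The norm of one vertex relative to \<open>G\<close> serves as the
        circumradius; it is positive because no vertex equals \<open>G\<close>.\<close>
      obtain v where v: "v \<in> C" using card by fastforce
      then have "0 < h v" by (rule h_pos)
      then have "\<exists>r>0. \<forall>w\<in>C. h w = r" if "equal_norms"
        using that v unfolding equal_norms_def by blast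
      moreover have "equal_norms" if "\<exists>r>0. \<forall>w\<in>C. h w = r"
        using that by (elim exE conjE) (simp add: equal_norms_def)
      ultimately show ?thesis by blast
    qed
    finally show ?thesis .
  qed
  \<comment> \<open>The centroid divides the median in the ratio \<open>d : 1\<close>, so the median
    is \<open>(d + 1) / d\<close> times the segment from \<open>v\<close> to
    \<open>G\<close>.\<close>
  have median: "median_length B T v = (real DIM('a) + 1) / real DIM('a) * h v" if v: "v \<in> C" for v
  proof -
    let ?c = "(real DIM('a) + 1) / real DIM('a)"
    have "(\<Sum>w\<in>C - {v}. w) = (real DIM('a) + 1) *\<^sub>R G - v"
      using sumC fin v by (simp add: sum_diff1)
    then have "median_foot T v - v = (1 / real DIM('a)) *\<^sub>R ((real DIM('a) + 1) *\<^sub>R G - v) - v"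
      by (simp add: median_foot_def V)
    also have "\<dots> = ?c *\<^sub>R (- (v - G))"
    proof -
      have "1 + 1 / real DIM('a) = ?c" by (simp add: field_simps)
      then have "?c *\<^sub>R v = v + (1 / real DIM('a)) *\<^sub>R v" by (metis scaleR_left.add scaleR_one)
      then have "?c *\<^sub>R (- (v - G)) = ?c *\<^sub>R G - (v + (1 / real DIM('a)) *\<^sub>R v)"
        by (simp only: minus_diff_eq scaleR_diff_right)
      then show ?thesis by (simp add: scaleR_diff_right)
    qed
    finally have "median_length B T v = mnorm B (?c *\<^sub>R (- (v - G)))"
      by (simp only: median_length_def)
    also have "\<dots> = ?c * mnorm B (- (v - G))" by (rule mnorm_scale_nonneg) simp
    finally show ?thesis by (simp only: mnorm_minus)
  qed
  have "median_length B T v = median_length B T w \<longleftrightarrow> h v = h w" if "v \<in> C" "w \<in> C" for v w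
    unfolding median[OF that(1)] median[OF that(2)] by (simp add: add_nonneg_eq_0_iff)
  then have medians: "(\<forall>v\<in>verts T. \<forall>w\<in>verts T. median_length B T v = median_length B T w)
      \<longleftrightarrow> equal_norms"
    unfolding V equal_norms_def by blast
  show ?thesis
    unfolding Td Bd_def centroid_eq AG medians mheights_iff quasi_medial_iff incenter_iff
      exradii_iff
    by (intro conjI refl)
qed

end
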